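(* Let $G=(G_1,G_2,G_3)\colon\mathbb{C}^3\to\mathbb{C}^3$ be a dominant polynomial map satisfying $G\circ\sigma_t=\tau_t\circ G$ for all $t\in\mathbb{C}^\times$, where $\sigma_t(x,y,z)=(tx,t^{-1}y,t^{-2}z)$ and $\tau_t(a,b,c)=(t^{-2}a,t^{-1}b,tc)$. Put $u=xy$, $v=x^2z$. Write the third component as $G_3=x\,\Lambda(u,v)$ with $\Lambda\in\mathbb{C}[u,v]$, and let $(P,Q)=(G_2G_3,\;G_1G_3^2)$, which are polynomials in $u,v$. Then, up to a universal sign (independent of $G$), $$\det JG=\pm\,\frac{\mathrm{Jac}_{u,v}(P,Q)}{\Lambda^2}.$$ In particular $G$ is a Keller map if and only if $$\mathrm{Jac}_{u,v}(P,Q)=\kappa\,\Lambda^2\qquad\text{for some }\kappa\in\mathbb{C}^\times,$$ that is, if and only if the Jacobian of the quotient map $(u,v)\mapsto(P,Q)$ vanishes exactly on $\{\Lambda=0\}$, to order two, with constant leading coefficient. For the map $F=(a,b,c)$ with $$a=(1+xy)^3z+y^2(1+xy)(4+3xy),\quad b=y+3x(1+xy)^2z+3xy^2(4+3xy),\quad c=2x-3x^2y-x^3z,$$ one has $\Lambda=L:=2-3u-v$ and $\mathrm{Jac}_{u,v}(P,Q)=2L^2$.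
   Context: $\det JG$ is the determinant of the Jacobian matrix of $G$ with respect to $x,y,z$. A Keller map is a polynomial map whose Jacobian determinant is a nonzero constant. $\mathrm{Jac}_{u,v}(P,Q)=P_uQ_v-P_vQ_u$. The ring of $\sigma$-invariant polynomials in $x,y,z$ is $\mathbb{C}[u,v]$, a polynomial ring; $(P,Q)$ is the map induced by $G$ on invariants, where the ring of $\tau$-invariant polynomials in the target coordinates $a,b,c$ is $\mathbb{C}[bc,ac^2]$. *)

theory Defs
  imports
    "HOL-Analysis.Analysis"
    "HOL-Computational_Algebra.Polynomial_Factorial"
    "HOL-Computational_Algebra.Field_as_Ring"
begin

text \<open>
  Multivariate polynomials are iterated univariate ones:
  \<open>bipoly\<close> is $\mathbb{C}[u][v]$ (outermost variable $v$) and
  \<open>tripoly\<close> is $\mathbb{C}[x][y][z]$ (outermost variable $z$).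
  The ring \<open>tripoly\<close> also serves as $\mathbb{C}[a][b][c]$, the polynomials on the target space.
\<close>

type_synonym bipoly = "complex poly poly"
type_synonym tripoly = "complex poly poly poly"

definition U :: bipoly where "U = [:[:0, 1:]:]"
definition V :: bipoly where "V = [:0, 1:]"

definition X :: tripoly where "X = [:[:[:0, 1:]:]:]"
definition Y :: tripoly where "Y = [:[:0, 1:]:]"
definition Z :: tripoly where "Z = [:0, 1:]"

definition const2 :: "complex \<Rightarrow> bipoly" where "const2 k = [:[:k:]:]"
definition const3 :: "complex \<Rightarrow> tripoly" where "const3 k = [:[:[:k:]:]:]"

definition eval2 :: "bipoly \<Rightarrow> complex \<Rightarrow> complex \<Rightarrow> complex" where
  "eval2 p s t = poly (poly p [:t:]) s"

definition eval3 :: "tripoly \<Rightarrow> complex ^ 3 \<Rightarrow> complex" where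
  "eval3 p w = poly (poly (poly p [:[:w $ 3:]:]) [:w $ 2:]) (w $ 1)"

text \<open>Substitution $p(u,v) \mapsto p(xy, x^2z)$, from $\mathbb{C}[u,v]$ to $\mathbb{C}[x,y,z]$:\<close>

definition at_uv :: "bipoly \<Rightarrow> tripoly" where
  "at_uv p = poly (map_poly (\<lambda>q. poly (map_poly const3 q) (X * Y)) p) (X\<^sup>2 * Z)"

definition partial_u :: "bipoly \<Rightarrow> bipoly" where "partial_u = map_poly pderiv"
definition partial_v :: "bipoly \<Rightarrow> bipoly" where "partial_v = pderiv"

definition Jac_uv :: "bipoly \<Rightarrow> bipoly \<Rightarrow> bipoly" where
  "Jac_uv P Q = partial_u P * partial_v Q - partial_v P * partial_u Q"

definition partial3 :: "3 \<Rightarrow> tripoly \<Rightarrow> tripoly" where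
  "partial3 i p =
    (if i = 1 then map_poly (map_poly pderiv) p
     else if i = 2 then map_poly pderiv p
     else pderiv p)"

definition jacobian_matrix :: "tripoly ^ 3 \<Rightarrow> tripoly ^ 3 ^ 3" where
  "jacobian_matrix G = (\<chi> i j. partial3 j (G $ i))"

definition polymap :: "tripoly ^ 3 \<Rightarrow> complex ^ 3 \<Rightarrow> complex ^ 3" where
  "polymap G w = (\<chi> i. eval3 (G $ i) w)"

definition keller :: "tripoly ^ 3 \<Rightarrow> bool" where
  "keller G \<longleftrightarrow> (\<exists>k. k \<noteq> 0 \<and> det (jacobian_matrix G) = const3 k)"

definition zariski_closed :: "(complex ^ 3) set \<Rightarrow> bool" where
  "zariski_closed S \<longleftrightarrow> (\<exists>I. S = {w. \<forall>p\<in>I. eval3 p w = 0})"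

definition dominant :: "tripoly ^ 3 \<Rightarrow> bool" where
  "dominant G \<longleftrightarrow> (\<forall>S. zariski_closed S \<and> range (polymap G) \<subseteq> S \<longrightarrow> S = UNIV)"

definition \<sigma> :: "complex \<Rightarrow> complex ^ 3 \<Rightarrow> complex ^ 3" where
  "\<sigma> t w = vector [t * w $ 1, inverse t * w $ 2, inverse (t\<^sup>2) * w $ 3]"

definition \<tau> :: "complex \<Rightarrow> complex ^ 3 \<Rightarrow> complex ^ 3" where
  "\<tau> t w = vector [inverse (t\<^sup>2) * w $ 1, inverse t * w $ 2, t * w $ 3]"

definition equivariant :: "tripoly ^ 3 \<Rightarrow> bool" where
  "equivariant G \<longleftrightarrow> (\<forall>t. t \<noteq> 0 \<longrightarrow> polymap G \<circ> \<sigma> t = \<tau> t \<circ> polymap G)"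

definition quotient_data :: "tripoly ^ 3 \<Rightarrow> bipoly \<Rightarrow> bipoly \<Rightarrow> bipoly \<Rightarrow> bool" where
  "quotient_data G \<Lambda> P Q \<longleftrightarrow>
     G $ 3 = X * at_uv \<Lambda> \<and>
     at_uv P = G $ 2 * G $ 3 \<and>
     at_uv Q = G $ 1 * (G $ 3)\<^sup>2"

text \<open>
  $J$ vanishes exactly on $\{\Lambda = 0\}$, to order two, with constant leading coefficient.
  Since \<open>\<Lambda>\<close> may be reducible or non-reduced, ``to order two'' is relative to \<open>\<Lambda>\<close>: along every
  irreducible curve, with prime equation \<open>p\<close>, the order of $J$ is twice that of \<open>\<Lambda>\<close>.
  The leading coefficient is the cofactor of \<open>\<Lambda>\<^sup>2\<close> in $J$; it is nonzero by the first conjunct.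
\<close>

definition vanishes_to_order_two_on :: "bipoly \<Rightarrow> bipoly \<Rightarrow> bool" where
  "vanishes_to_order_two_on J \<Lambda> \<longleftrightarrow>
     {(s, t). eval2 J s t = 0} = {(s, t). eval2 \<Lambda> s t = 0} \<and>
     (\<forall>p. prime_elem p \<longrightarrow> multiplicity p J = 2 * multiplicity p \<Lambda>) \<and>
     (\<exists>k. J = const2 k * \<Lambda>\<^sup>2)"

definition F :: "tripoly ^ 3" where
  "F = vector
     [(1 + X * Y) ^ 3 * Z + Y\<^sup>2 * (1 + X * Y) * (4 + 3 * X * Y),
      Y + 3 * X * (1 + X * Y)\<^sup>2 * Z + 3 * X * Y\<^sup>2 * (4 + 3 * X * Y),
      2 * X - 3 * X\<^sup>2 * Y - X ^ 3 * Z]"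

definition L :: bipoly where "L = 2 - 3 * U - V"

end

theory Submission
  imports Defs
begin

text \<open>
  Write $a, b, c$ for the components of $G$. Equivariance says that $a, b, c$ are homogeneous of
  weights $-2, -1, 1$ for the grading in which $x, y, z$ have weights $1, -1, -2$. Where
  $x \neq 0$, the choice $t = 1/x$ moves the point $(x,y,z)$ to $(1, u, v)$ with $u = xy$ and
  $v = x^2 z$, so a polynomial $p$ of weight $n \geq 0$ satisfies $p(x,y,z) = x^n\,p(1,u,v)$
  (\<open>at_uv_restrict_x1\<close>). Applied to $c$, $bc$ and $ac^2$ this produces $\Lambda$, $P$ and $Q$.
  They are unique because $(x,y,z) \mapsto (u,v)$ is onto.

  For the determinant, compute the 3-form $dQ \wedge dP \wedge dc$ in two ways. Modulo multiples
  of $dc$, the forms $dQ = d(ac^2)$ and $dP = d(bc)$ are $c^2\,da$ and $c\,db$, so the 3-form is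
  $c^3 \det JG\; dx \wedge dy \wedge dz$ (\<open>det_times_cube\<close>). On the other hand
  $dP \wedge dQ = \mathrm{Jac}(P,Q)\, du \wedge dv$, and $c = x\Lambda(u,v)$ gives
  $dc \equiv \Lambda\,dx$ modulo $du, dv$, while
  $du \wedge dv \wedge dx = x^3\, dx \wedge dy \wedge dz$; so the same 3-form is
  $-x^3 \Lambda\, \mathrm{Jac}(P,Q)\, dx \wedge dy \wedge dz$ (\<open>quotient_det_identity\<close>).
  Since $c^3 = x^3\Lambda^3$, cancelling $x^3\Lambda$ leaves
  $\Lambda^2 \det JG = -\mathrm{Jac}(P,Q)$, with the universal sign $-1$
  (\<open>det_jacobian_quotient\<close>). The cancellation needs $\Lambda \neq 0$, which is where dominance
  enters: otherwise the image lies in the plane $c = 0$.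

  Since the substitution of $(u,v)$ is injective, constancy of the determinant becomes
  $\mathrm{Jac}(P,Q) = \kappa\Lambda^2$. This already contains the geometric description, as
  multiplicities are additive and constants are units.

  For the map \<open>F\<close> everything except dominance is a computation. Dominance holds because the
  derivative at the origin is invertible, so the image contains an open ball, and a nonzero
  polynomial cannot vanish on one.
\<close>

section \<open>Polynomials as functions\<close>

lemma eval2_simps [simp]:
  "eval2 0 s t = 0" "eval2 1 s t = 1" "eval2 (numeral m) s t = numeral m"
  "eval2 (p + q) s t = eval2 p s t + eval2 q s t"
  "eval2 (p - q) s t = eval2 p s t - eval2 q s t"
  "eval2 (p * q) s t = eval2 p s t * eval2 q s t"
  "eval2 (p ^ n) s t = eval2 p s t ^ n"
  "eval2 (const2 k) s t = k" "eval2 U s t = s" "eval2 V s t = t"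
  by (simp_all add: eval2_def const2_def U_def V_def)

lemma eval3_simps [simp]:
  "eval3 0 w = 0" "eval3 1 w = 1" "eval3 (numeral m) w = numeral m"
  "eval3 (p + q) w = eval3 p w + eval3 q w"
  "eval3 (p - q) w = eval3 p w - eval3 q w"
  "eval3 (- p) w = - eval3 p w"
  "eval3 (p * q) w = eval3 p w * eval3 q w"
  "eval3 (p ^ n) w = eval3 p w ^ n"
  "eval3 (const3 k) w = k" "eval3 X w = w $ 1" "eval3 Y w = w $ 2" "eval3 Z w = w $ 3"
  by (simp_all add: eval3_def const3_def X_def Y_def Z_def)

lemma poly_zero_if_infinite_roots:
  fixes p :: "'a::idom poly"
  assumes "infinite S" "\<And>x. x \<in> S \<Longrightarrow> poly p x = 0"
  shows "p = 0"
proof (rule ccontr)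
  assume "p \<noteq> 0"
  then have "finite {x. poly p x = 0}" by (rule poly_roots_finite)
  with assms show False by (meson finite_subset mem_Collect_eq subsetI)
qed

text \<open>
  Boxes, rather than the whole space, because dominance of \<open>F\<close> requires that a polynomial is
  determined by its values on an open set. The outermost variable goes first: each of its infinitely
  many values is a root with coefficients in the polynomial ring of the other variables.
\<close>

lemma eval2_zero_on_box:
  assumes "infinite A" "infinite B" "\<And>s t. s \<in> A \<Longrightarrow> t \<in> B \<Longrightarrow> eval2 p s t = 0"
  shows "p = 0"
proof (rule poly_zero_if_infinite_roots)
  show "infinite ((\<lambda>t. [:t:]) ` B)"
    using assms(2) by (simp add: finite_image_iff inj_on_def)
  show "poly p x = 0" if "x \<in> (\<lambda>t. [:t:]) ` B" for x
    using that assms(1,3) by (auto simp: eval2_def intro: poly_zero_if_infinite_roots)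
qed

lemma eval3_zero_on_box:
  assumes "\<And>i. infinite (A i)" "\<And>w. (\<And>i. w $ i \<in> A i) \<Longrightarrow> eval3 p w = 0"
  shows "p = 0"
proof (rule poly_zero_if_infinite_roots)
  show "infinite ((\<lambda>z. [:[:z:]:]) ` A 3)"
    using assms(1)[of 3] by (simp add: finite_image_iff inj_on_def)
  show "poly p x = 0" if "x \<in> (\<lambda>z. [:[:z:]:]) ` A 3" for x
  proof (rule eval2_zero_on_box)
    from that obtain z where z: "z \<in> A 3" "x = [:[:z:]:]" by auto
    show "eval2 (poly p x) s t = 0" if "s \<in> A 1" "t \<in> A 2" for s t
    proof -
      have "(vector [s, t, z] :: complex ^ 3) $ i \<in> A i" for i
        using that z exhaust_3[of i] by auto
      from assms(2)[OF this] z show ?thesis by (simp add: eval2_def eval3_def)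
    qed
  qed (use assms(1) in auto)
qed

lemma eval2_eqI: "(\<And>s t. eval2 p s t = eval2 q s t) \<Longrightarrow> p = q"
  using eval2_zero_on_box[of UNIV UNIV "p - q"] infinite_UNIV_char_0 by simp

lemma eval3_eqI: "(\<And>w. eval3 p w = eval3 q w) \<Longrightarrow> p = q"
  using eval3_zero_on_box[of "\<lambda>_. UNIV" "p - q"] infinite_UNIV_char_0 by simp

lemma const3_uminus: "const3 (- k) = - const3 k"
  by (rule eval3_eqI) simp

lemma X_nonzero [simp]: "X \<noteq> 0"
  by (simp add: X_def)

text \<open>
  Multiplying the difference of the two sides by \<open>X\<close> makes it vanish on the plane \<open>x = 0\<close> too.
  This is what allows an argument that divides by $x$.
\<close>

lemma eval3_eqI_nonzero_x:
  assumes "\<And>w. w $ 1 \<noteq> 0 \<Longrightarrow> eval3 p w = eval3 q w"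
  shows "p = q"
proof -
  have "X * (p - q) = 0"
  proof (rule eval3_eqI)
    show "eval3 (X * (p - q)) w = eval3 0 w" for w
      using assms[of w] by (cases "w $ 1 = 0") auto
  qed
  then show ?thesis by simp
qed

lemma open_vec_contains_box:
  fixes S :: "(complex ^ 3) set"
  assumes "open S" "s \<in> S"
  obtains A where "\<And>i. infinite (A i)" "\<And>w. (\<And>i. w $ i \<in> A i) \<Longrightarrow> w \<in> S"
proof -
  from assms obtain A where A: "\<forall>i. open (A i) \<and> s $ i \<in> A i" "\<forall>y. (\<forall>i. y $ i \<in> A i) \<longrightarrow> y \<in> S"
    unfolding open_vec_def by blast
  have "infinite (A i)" for i
    using A(1) infinite_openin[of UNIV "A i" "s $ i"] islimpt_UNIV by auto
  with A(2) show ?thesis by (intro that[of A]) auto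
qed

lemma eval3_zero_on_open:
  assumes "open S" "s \<in> S" "\<And>w. w \<in> S \<Longrightarrow> eval3 p w = 0"
  shows "p = 0"
  using assms by (metis open_vec_contains_box eval3_zero_on_box)

section \<open>Invariants\<close>

text \<open>
  Together with the injectivity of evaluation, this reduces every identity for \<open>at_uv\<close>, including
  that it is a ring homomorphism, to one between complex numbers.
\<close>

lemma eval3_at_uv [simp]: "eval3 (at_uv p) w = eval2 p (w $ 1 * w $ 2) ((w $ 1)\<^sup>2 * w $ 3)"
proof -
  have inner: "eval3 (poly (map_poly const3 q) (X * Y)) w = poly q (w $ 1 * w $ 2)" for q
    by (induction q) (simp_all add: map_poly_pCons const3_def[of 0])
  show ?thesis
    unfolding at_uv_def
  proof (induction p)
    case 0
    then show ?case by simp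
  next
    case (pCons a p)
    have "poly (map_poly const3 0) (X * Y) = 0" by simp
    then show ?case
      using pCons by (simp add: map_poly_pCons inner) (simp add: eval2_def)
  qed
qed

lemma at_uv_simps [simp]:
  "at_uv 1 = 1" "at_uv (numeral m) = numeral m" "at_uv (p + q) = at_uv p + at_uv q"
  "at_uv (p - q) = at_uv p - at_uv q" "at_uv (p * q) = at_uv p * at_uv q"
  "at_uv (p ^ n) = at_uv p ^ n" "at_uv (const2 k) = const3 k"
  "at_uv U = X * Y" "at_uv V = X\<^sup>2 * Z"
  by (rule eval3_eqI; simp)+

text \<open>The slice $x = 1$ is mapped bijectively onto the $(u,v)$-plane.\<close>

lemma at_uv_inject [simp]: "at_uv p = at_uv q \<longleftrightarrow> p = q"
proof
  assume eq: "at_uv p = at_uv q"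
  show "p = q"
  proof (rule eval2_eqI)
    show "eval2 p s t = eval2 q s t" for s t
      using arg_cong[OF eq, of "\<lambda>r. eval3 r (vector [1, s, t])"] by simp
  qed
qed simp

lemma at_uv_0 [simp]: "at_uv 0 = 0"
  by (rule eval3_eqI) simp

text \<open>
  The remaining variables $y, z$ become $u, v$: on the slice $x = 1$ these are the values of
  $xy$ and $x^2z$.
\<close>

definition restrict_x1 :: "tripoly \<Rightarrow> bipoly" where
  "restrict_x1 = map_poly (map_poly (\<lambda>q. poly q 1))"

lemma eval2_restrict_x1: "eval2 (restrict_x1 p) s t = eval3 p (vector [1, s, t])"
proof -
  have inner: "poly (map_poly (\<lambda>q. poly q 1) r) s = poly (poly r [:s:]) 1" for r :: bipoly
    by (induction r) (simp_all add: map_poly_pCons)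
  show ?thesis
    unfolding restrict_x1_def eval2_def eval3_def vector_3
    by (induction p) (simp_all add: map_poly_pCons inner)
qed

lemma equivariant_eval:
  assumes "equivariant G" "t \<noteq> 0"
  shows "eval3 (G $ 1) (\<sigma> t w) = inverse (t\<^sup>2) * eval3 (G $ 1) w"
    and "eval3 (G $ 2) (\<sigma> t w) = inverse t * eval3 (G $ 2) w"
    and "eval3 (G $ 3) (\<sigma> t w) = t * eval3 (G $ 3) w"
proof -
  have "polymap G (\<sigma> t w) = \<tau> t (polymap G w)"
    using assms by (auto simp: equivariant_def fun_eq_iff)
  then have "polymap G (\<sigma> t w) $ i = \<tau> t (polymap G w) $ i" for i by simp
  from this[of 1] this[of 2] this[of 3]
  show "eval3 (G $ 1) (\<sigma> t w) = inverse (t\<^sup>2) * eval3 (G $ 1) w"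
    "eval3 (G $ 2) (\<sigma> t w) = inverse t * eval3 (G $ 2) w"
    "eval3 (G $ 3) (\<sigma> t w) = t * eval3 (G $ 3) w"
    by (simp_all add: polymap_def \<tau>_def)
qed

text \<open>
  Taking $t = 1/x$ in the homogeneity relation moves a point to the slice $x = 1$ without changing
  its invariants.
\<close>

lemma at_uv_restrict_x1:
  assumes "\<And>t w. t \<noteq> 0 \<Longrightarrow> eval3 p (\<sigma> t w) = t ^ n * eval3 p w"
  shows "p = X ^ n * at_uv (restrict_x1 p)"
proof (rule eval3_eqI_nonzero_x)
  fix w :: "complex ^ 3"
  assume nz: "w $ 1 \<noteq> 0"
  have "\<sigma> (inverse (w $ 1)) w = vector [1, w $ 1 * w $ 2, (w $ 1)\<^sup>2 * w $ 3]"
    using nz by (simp add: \<sigma>_def power_inverse)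
  then show "eval3 p w = eval3 (X ^ n * at_uv (restrict_x1 p)) w"
    using assms[of "inverse (w $ 1)" w] nz by (simp add: eval2_restrict_x1 field_simps)
qed

lemma quotient_data_exists:
  assumes "equivariant G"
  shows "\<exists>\<Lambda> P Q. quotient_data G \<Lambda> P Q"
proof -
  note ev = equivariant_eval[OF assms]
  have "G $ 3 = X ^ 1 * at_uv (restrict_x1 (G $ 3))"
    by (rule at_uv_restrict_x1) (simp add: ev)
  moreover have "G $ 2 * G $ 3 = at_uv (restrict_x1 (G $ 2 * G $ 3))"
    using at_uv_restrict_x1[of "G $ 2 * G $ 3" 0] by (simp add: ev)
  moreover have "G $ 1 * (G $ 3)\<^sup>2 = at_uv (restrict_x1 (G $ 1 * (G $ 3)\<^sup>2))"
    using at_uv_restrict_x1[of "G $ 1 * (G $ 3)\<^sup>2" 0] by (simp add: ev power_mult_distrib)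
  ultimately show ?thesis unfolding quotient_data_def by (metis power_one_right)
qed

lemma quotient_data_unique:
  assumes "quotient_data G \<Lambda> P Q" "quotient_data G \<Lambda>' P' Q'"
  shows "\<Lambda> = \<Lambda>'" "P = P'" "Q = Q'"
proof -
  have "X * at_uv \<Lambda> = X * at_uv \<Lambda>'" "at_uv P = at_uv P'" "at_uv Q = at_uv Q'"
    using assms unfolding quotient_data_def by metis+
  then show "\<Lambda> = \<Lambda>'" "P = P'" "Q = Q'" by simp_all
qed

section \<open>Derivations and the chain rule\<close>

locale derivation =
  fixes D :: "'a::comm_ring_1 \<Rightarrow> 'a"
  assumes add: "D (p + q) = D p + D q"
    and mult: "D (p * q) = D p * q + p * D q"
begin

lemma zero: "D 0 = 0"
  using add[of 0 0] by simp

lemma one: "D 1 = 0"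
  using mult[of 1 1] by simp

lemma diff: "D (p - q) = D p - D q"
  using add[of "p - q" q] by (simp add: algebra_simps)

lemma numeral: "D (numeral n) = 0"
  by (induction n) (simp_all only: numeral.simps add one add_0_left)

lemma square: "D (p\<^sup>2) = 2 * p * D p"
  by (simp add: power2_eq_square mult algebra_simps)

lemma cube: "D (p ^ 3) = 3 * p\<^sup>2 * D p"
  by (simp add: power2_eq_square power3_eq_cube mult algebra_simps)

lemmas rules = zero one add diff mult numeral square cube

text \<open>
  The partial derivatives in the inner variables of an iterated polynomial ring act coefficientwise,
  so they inherit the product rule from the ring of coefficients.
\<close>

lemma map_poly: "derivation (map_poly D)"
proof
  show add': "map_poly D (p + q) = map_poly D p + map_poly D q" for p q
    by (rule poly_eqI) (simp add: coeff_map_poly zero add)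
  have smult: "map_poly D (smult a q) = smult (D a) q + smult a (map_poly D q)" for a q
    by (rule poly_eqI) (simp add: coeff_map_poly zero mult)
  show "map_poly D (p * q) = map_poly D p * q + p * map_poly D q" for p q
    by (induction p) (simp_all add: map_poly_pCons zero add' smult algebra_simps)
qed

end

lemma derivation_pderiv: "derivation (pderiv :: 'a::idom poly \<Rightarrow> 'a poly)"
  by standard (simp_all add: pderiv_add pderiv_mult algebra_simps)

lemma derivation_partial_u: "derivation partial_u"
  unfolding partial_u_def by (intro derivation.map_poly derivation_pderiv)

lemma derivation_partial_v: "derivation partial_v"
  unfolding partial_v_def by (rule derivation_pderiv)

lemma derivation_partial3: "derivation (partial3 i)"
proof -
  have "partial3 i = map_poly (map_poly pderiv) \<or> partial3 i = map_poly pderiv \<or> partial3 i = pderiv"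
    by (auto simp: partial3_def fun_eq_iff)
  then show ?thesis
    by (elim disjE; simp only: derivation.map_poly derivation_pderiv)
qed

lemma partial_uv_simps [simp]:
  "partial_u (const2 k) = 0" "partial_u U = 1" "partial_u V = 0"
  "partial_v (const2 k) = 0" "partial_v U = 0" "partial_v V = 1"
  by (simp_all add: partial_u_def partial_v_def const2_def U_def V_def map_poly_pCons pderiv_pCons
      one_pCons)

lemma partial3_simps [simp]:
  "partial3 i (const3 k) = 0"
  "partial3 1 X = 1" "partial3 2 X = 0" "partial3 3 X = 0"
  "partial3 1 Y = 0" "partial3 2 Y = 1" "partial3 3 Y = 0"
  "partial3 1 Z = 0" "partial3 2 Z = 0" "partial3 3 Z = 1"
  by (simp_all add: partial3_def const3_def X_def Y_def Z_def map_poly_pCons pderiv_pCons one_pCons)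

text \<open>
  A two-variable polynomial is built from constants and the two variables by ring operations, so an
  identity between derivations composed with \<open>at_uv\<close> need only be checked on these.
\<close>

lemma bipoly_induct [case_names const U V add mult]:
  assumes const: "\<And>k. S (const2 k)" and U: "S U" and V: "S V"
    and add: "\<And>p q. S p \<Longrightarrow> S q \<Longrightarrow> S (p + q)"
    and mult: "\<And>p q. S p \<Longrightarrow> S q \<Longrightarrow> S (p * q)"
  shows "S p"
proof -
  have coefficient: "S [:r:]" for r
  proof (induction r)
    case 0
    show ?case using const[of 0] by (simp add: const2_def)
  next
    case (pCons a r)
    have "[:pCons a r:] = const2 a + U * [:r:]" by (simp add: const2_def U_def)
    with pCons const U add mult show ?case by metis
  qed
  show ?thesis
  proof (induction p)
    case 0
    show ?case using const[of 0] by (simp add: const2_def)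
  next
    case (pCons r p)
    have "pCons r p = [:r:] + V * p" by (simp add: V_def)
    with pCons coefficient V add mult show ?case by metis
  qed
qed

lemma partial3_at_uv:
  "partial3 i (at_uv p) =
     at_uv (partial_u p) * partial3 i (X * Y) + at_uv (partial_v p) * partial3 i (X\<^sup>2 * Z)"
proof -
  interpret u: derivation partial_u by (rule derivation_partial_u)
  interpret v: derivation partial_v by (rule derivation_partial_v)
  interpret d: derivation "partial3 i" by (rule derivation_partial3)
  show ?thesis
    by (induction p rule: bipoly_induct)
      (simp_all add: d.add u.add v.add d.mult[of "at_uv _"] u.mult v.mult algebra_simps)
qed

section \<open>The determinant formula\<close>

text \<open>
  The rows \<open>A\<close> and \<open>B\<close> are the gradients of $ac^2$ and $bc$. Multiples of the third row, the
  gradient of $c$, can be subtracted from them, which leaves $c^2$ and $c$ times the rows \<open>a\<close> and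
  \<open>b\<close>.
\<close>

lemma det_times_cube:
  fixes a b c :: "'a::idom"
  shows "c ^ 3 * (a1 * b2 * c3 + a2 * b3 * c1 + a3 * b1 * c2 - a1 * b3 * c2 - a2 * b1 * c3 - a3 * b2 * c1)
    = (let A1 = a1 * c\<^sup>2 + a * (2 * c * c1); A2 = a2 * c\<^sup>2 + a * (2 * c * c2);
           A3 = a3 * c\<^sup>2 + a * (2 * c * c3);
           B1 = b1 * c + b * c1; B2 = b2 * c + b * c2; B3 = b3 * c + b * c3
       in A1 * B2 * c3 + A2 * B3 * c1 + A3 * B1 * c2 - A1 * B3 * c2 - A2 * B1 * c3 - A3 * B2 * c1)"
  unfolding Let_def by algebra

text \<open>
  The assumptions express the gradients of $Q$, $P$ and $c = x\Lambda$ by the chain rule, from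
  $\nabla u = (y, x, 0)$ and $\nabla v = (2xz, 0, x^2)$; the letters \<open>l\<close>, \<open>lu\<close>, \<open>lv\<close> stand for
  $\Lambda$ and its two partial derivatives.
\<close>

lemma quotient_det_identity:
  fixes x y z :: "'a::idom"
  assumes "A1 = qu * y + qv * (2 * x * z)" "A2 = qu * x" "A3 = qv * x\<^sup>2"
    and "B1 = pu * y + pv * (2 * x * z)" "B2 = pu * x" "B3 = pv * x\<^sup>2"
    and "c1 = l + x * (lu * y + lv * (2 * x * z))" "c2 = x * (lu * x)" "c3 = x * (lv * x\<^sup>2)"
  shows "A1 * B2 * c3 + A2 * B3 * c1 + A3 * B1 * c2 - A1 * B3 * c2 - A2 * B1 * c3 - A3 * B2 * c1
    = - (x ^ 3 * l * (pu * qv - pv * qu))"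
  unfolding assms by algebra

lemma det_jacobian_quotient:
  assumes "quotient_data G \<Lambda> P Q" "\<Lambda> \<noteq> 0"
  shows "det (jacobian_matrix G) * (at_uv \<Lambda>)\<^sup>2 = - at_uv (Jac_uv P Q)"
proof -
  define d where "d i j = partial3 j (G $ i)" for i j
  define l where "l = at_uv \<Lambda>"
  have c: "G $ 3 = X * l" and P: "at_uv P = G $ 2 * G $ 3" and Q: "at_uv Q = G $ 1 * (G $ 3)\<^sup>2"
    using assms(1) by (simp_all add: quotient_data_def l_def)
  have det: "det (jacobian_matrix G) = d 1 1 * d 2 2 * d 3 3 + d 1 2 * d 2 3 * d 3 1
      + d 1 3 * d 2 1 * d 3 2 - d 1 1 * d 2 3 * d 3 2 - d 1 2 * d 2 1 * d 3 3 - d 1 3 * d 2 2 * d 3 1"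
    by (simp add: det_3 jacobian_matrix_def d_def)
  define pu pv qu qv lu lv where "pu = at_uv (partial_u P)" "pv = at_uv (partial_v P)"
    "qu = at_uv (partial_u Q)" "qv = at_uv (partial_v Q)"
    "lu = at_uv (partial_u \<Lambda>)" "lv = at_uv (partial_v \<Lambda>)"
  note coeffs = this
  note D = derivation.mult[OF derivation_partial3] derivation.square[OF derivation_partial3]
  have DQ: "d 1 j * (G $ 3)\<^sup>2 + G $ 1 * (2 * (G $ 3) * d 3 j)
      = qu * partial3 j (X * Y) + qv * partial3 j (X\<^sup>2 * Z)" for j
    using arg_cong[OF Q, of "partial3 j"] by (simp add: partial3_at_uv D coeffs d_def)
  have DP: "d 2 j * (G $ 3) + G $ 2 * d 3 j
      = pu * partial3 j (X * Y) + pv * partial3 j (X\<^sup>2 * Z)" for j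
    using arg_cong[OF P, of "partial3 j"] by (simp add: partial3_at_uv D coeffs d_def)
  have Dc: "d 3 j = partial3 j X * l + X * (lu * partial3 j (X * Y) + lv * partial3 j (X\<^sup>2 * Z))" for j
    by (simp add: d_def c D(1)[of j X l] partial3_at_uv[of j \<Lambda>, folded l_def] coeffs)
  have "(X * l) ^ 3 * det (jacobian_matrix G) = - (X ^ 3 * l * (pu * qv - pv * qu))"
    unfolding det c[symmetric] det_times_cube[where a = "G $ 1" and b = "G $ 2"] Let_def DQ DP
    by (rule quotient_det_identity[where y = Y and z = Z and lu = lu and lv = lv])
      (simp_all add: Dc D)
  then have "(X ^ 3 * l) * (det (jacobian_matrix G) * l\<^sup>2) = (X ^ 3 * l) * - (pu * qv - pv * qu)"
    by (simp add: power_mult_distrib power2_eq_square power3_eq_cube algebra_simps)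
  moreover have "X ^ 3 * l \<noteq> 0"
    using assms(2) at_uv_inject[of \<Lambda> 0] by (simp add: l_def)
  ultimately have "det (jacobian_matrix G) * l\<^sup>2 = - (pu * qv - pv * qu)"
    by (metis mult_left_cancel)
  then show ?thesis by (simp add: l_def coeffs Jac_uv_def)
qed

lemma dominant_quotient_nonzero:
  assumes "dominant G" "quotient_data G \<Lambda> P Q"
  shows "\<Lambda> \<noteq> 0"
proof
  assume "\<Lambda> = 0"
  then have "G $ 3 = 0" using assms(2) by (simp add: quotient_data_def)
  define S where "S = {w. \<forall>p\<in>{Z}. eval3 p w = 0}"
  have "zariski_closed S" unfolding zariski_closed_def S_def by blast
  moreover have "range (polymap G) \<subseteq> S"
    using \<open>G $ 3 = 0\<close> by (auto simp: S_def polymap_def)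
  ultimately have "S = UNIV" using assms(1) by (auto simp: dominant_def)
  then have "(vector [0, 0, 1] :: complex ^ 3) \<in> S" by simp
  then show False by (simp add: S_def)
qed

lemma keller_iff_quotient_Jacobian:
  assumes "quotient_data G \<Lambda> P Q" "\<Lambda> \<noteq> 0"
  shows "keller G \<longleftrightarrow> (\<exists>\<kappa>. \<kappa> \<noteq> 0 \<and> Jac_uv P Q = const2 \<kappa> * \<Lambda>\<^sup>2)"
proof -
  have nz: "at_uv \<Lambda> \<noteq> 0" using assms(2) at_uv_inject[of \<Lambda> 0] by simp
  have "det (jacobian_matrix G) = const3 k \<longleftrightarrow> Jac_uv P Q = const2 (- k) * \<Lambda>\<^sup>2" for k
  proof -
    have "det (jacobian_matrix G) = const3 k
        \<longleftrightarrow> det (jacobian_matrix G) * (at_uv \<Lambda>)\<^sup>2 = const3 k * (at_uv \<Lambda>)\<^sup>2"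
      using nz by simp
    also have "\<dots> \<longleftrightarrow> at_uv (Jac_uv P Q) = const3 (- k) * (at_uv \<Lambda>)\<^sup>2"
      unfolding det_jacobian_quotient[OF assms]
      by (metis const3_uminus minus_equation_iff mult_minus_left)
    also have "\<dots> \<longleftrightarrow> at_uv (Jac_uv P Q) = at_uv (const2 (- k) * \<Lambda>\<^sup>2)" by simp
    finally show ?thesis by (simp only: at_uv_inject)
  qed
  then show ?thesis
    unfolding keller_def by (metis add.inverse_inverse neg_equal_0_iff_equal)
qed

text \<open>
  From left to right only $\kappa \neq 0$ is at stake: for $\kappa = 0$ the zero set of $J$ would
  be the whole plane, which is not the zero set of a nonzero \<open>\<Lambda>\<close>.
\<close>

lemma vanishes_to_order_two_on_iff:
  assumes "\<Lambda> \<noteq> 0"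
  shows "vanishes_to_order_two_on J \<Lambda> \<longleftrightarrow> (\<exists>\<kappa>. \<kappa> \<noteq> 0 \<and> J = const2 \<kappa> * \<Lambda>\<^sup>2)"
proof
  assume "vanishes_to_order_two_on J \<Lambda>"
  then obtain k where zeros: "{(s, t). eval2 J s t = 0} = {(s, t). eval2 \<Lambda> s t = 0}"
    and k: "J = const2 k * \<Lambda>\<^sup>2"
    unfolding vanishes_to_order_two_on_def by blast
  have "k \<noteq> 0"
  proof
    assume "k = 0"
    with k zeros have "\<Lambda> = 0"
      by (intro eval2_eqI) (auto simp: set_eq_iff)
    with assms show False by simp
  qed
  with k show "\<exists>\<kappa>. \<kappa> \<noteq> 0 \<and> J = const2 \<kappa> * \<Lambda>\<^sup>2" by blast
next
  assume "\<exists>\<kappa>. \<kappa> \<noteq> 0 \<and> J = const2 \<kappa> * \<Lambda>\<^sup>2"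
  then obtain k where k: "k \<noteq> 0" "J = const2 k * \<Lambda>\<^sup>2" by blast
  have "const2 k * const2 (inverse k) = 1"
    using k(1) by (intro eval2_eqI) simp
  then have "is_unit (const2 k)" by (metis dvd_triv_left)
  then have "multiplicity p J = 2 * multiplicity p \<Lambda>" if "prime_elem p" for p
    using that assms
    by (simp add: k(2) multiplicity_times_unit_right prime_elem_multiplicity_power_distrib)
  then show "vanishes_to_order_two_on J \<Lambda>"
    using k by (auto simp: vanishes_to_order_two_on_def)
qed

section \<open>The map \<open>F\<close>\<close>

lemma polymap_F: "polymap F w =
    (let x = w $ 1; y = w $ 2; z = w $ 3 in
     vector [(1 + x * y) ^ 3 * z + y\<^sup>2 * (1 + x * y) * (4 + 3 * x * y),
      y + 3 * x * (1 + x * y)\<^sup>2 * z + 3 * x * y\<^sup>2 * (4 + 3 * x * y),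
      2 * x - 3 * x\<^sup>2 * y - x ^ 3 * z])"
  by (simp add: polymap_def F_def vec_eq_iff forall_3 Let_def)

lemma equivariant_F: "equivariant F"
  unfolding equivariant_def
proof (intro allI impI ext)
  fix t :: complex and w :: "complex ^ 3"
  assume "t \<noteq> 0"
  define r where "r = inverse t"
  have inv: "t * r = 1" "inverse (t\<^sup>2) = r\<^sup>2"
    using \<open>t \<noteq> 0\<close> by (simp_all add: r_def power_inverse)
  \<comment> \<open>The invariant $xy$ is isolated first; in what remains the weights are visible.\<close>
  have xy: "t * x * (r * y) = x * y" "3 * (t * x) * (r * y) = 3 * x * y" for x y
    using inv(1) by algebra+
  have first: "(1 + t * x * (r * y)) ^ 3 * (r\<^sup>2 * z)
        + (r * y)\<^sup>2 * (1 + t * x * (r * y)) * (4 + 3 * (t * x) * (r * y))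
      = r\<^sup>2 * ((1 + x * y) ^ 3 * z + y\<^sup>2 * (1 + x * y) * (4 + 3 * x * y))" for x y z
    unfolding xy by algebra
  have second: "r * y + 3 * (t * x) * (1 + t * x * (r * y))\<^sup>2 * (r\<^sup>2 * z)
        + 3 * (t * x) * (r * y)\<^sup>2 * (4 + 3 * (t * x) * (r * y))
      = r * (y + 3 * x * (1 + x * y)\<^sup>2 * z + 3 * x * y\<^sup>2 * (4 + 3 * x * y))" for x y z
    unfolding xy using inv(1) by algebra
  have third: "2 * (t * x) - 3 * (t * x)\<^sup>2 * (r * y) - (t * x) ^ 3 * (r\<^sup>2 * z)
      = t * (2 * x - 3 * x\<^sup>2 * y - x ^ 3 * z)" for x y z
    using inv(1) by algebra
  have "polymap F (\<sigma> t w) $ i = \<tau> t (polymap F w) $ i" for i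
    using exhaust_3[of i]
    by (elim disjE) (simp_all only: polymap_F Let_def \<sigma>_def \<tau>_def vector_3 first second third
        inv(2) flip: r_def)
  then show "(polymap F \<circ> \<sigma> t) w = (\<tau> t \<circ> polymap F) w"
    by (simp add: vec_eq_iff)
qed

text \<open>
  The polynomials \<open>A\<close> and \<open>B\<close> are the weight-zero expressions $xb$ and $x^2a$ in terms of
  $u, v$; since $c = xL$, this gives $bc = AL$ and $ac^2 = BL^2$.
\<close>

lemma quotient_data_F:
  fixes A B :: bipoly
  defines "A \<equiv> U + 3 * (1 + U)\<^sup>2 * V + 3 * U\<^sup>2 * (4 + 3 * U)"
    and "B \<equiv> (1 + U) ^ 3 * V + U\<^sup>2 * (1 + U) * (4 + 3 * U)"
  shows "quotient_data F L (A * L) (B * L\<^sup>2)"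
    and "Jac_uv (A * L) (B * L\<^sup>2) = 2 * L\<^sup>2"
proof -
  show "quotient_data F L (A * L) (B * L\<^sup>2)"
    unfolding quotient_data_def F_def A_def B_def L_def vector_3 at_uv_simps
    by (intro conjI; algebra)
  interpret u: derivation partial_u by (rule derivation_partial_u)
  interpret v: derivation partial_v by (rule derivation_partial_v)
  have "partial_u L = -3" "partial_v L = -1"
    by (simp_all add: L_def u.rules v.rules)
  moreover have "partial_u A = 1 + 6 * (1 + U) * V + 24 * U + 27 * U\<^sup>2"
    unfolding A_def by (simp add: u.rules) algebra
  moreover have "partial_v A = 3 * (1 + U)\<^sup>2"
    unfolding A_def by (simp add: v.rules)
  moreover have "partial_u B = 3 * (1 + U)\<^sup>2 * V + 8 * U + 21 * U\<^sup>2 + 12 * U ^ 3"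
    unfolding B_def by (simp add: u.rules) algebra
  moreover have "partial_v B = (1 + U) ^ 3"
    unfolding B_def by (simp add: v.rules)
  ultimately show "Jac_uv (A * L) (B * L\<^sup>2) = 2 * L\<^sup>2"
    unfolding Jac_uv_def u.mult v.mult u.square v.square
    by (simp only:) (simp add: A_def B_def L_def algebra_simps power2_eq_square power3_eq_cube)
qed

lemma has_derivative_vec_componentwise:
  fixes f :: "'a::real_normed_vector \<Rightarrow> 'b::euclidean_space ^ 'n"
  assumes "\<And>i. ((\<lambda>x. f x $ i) has_derivative (\<lambda>h. f' h $ i)) (at a)"
  shows "(f has_derivative f') (at a)"
  unfolding has_derivative_componentwise_within[of f]
  by (auto simp: Basis_vec_def inner_axis intro: has_derivative_inner_left assms)

lemma continuous_on_polymap_F: "continuous_on UNIV (polymap F)"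
proof -
  have "continuous_on UNIV (\<lambda>w. polymap F w $ i)" for i
    using exhaust_3[of i]
    by (elim disjE; simp add: polymap_F Let_def; intro continuous_intros)
  then have "continuous_on UNIV (\<lambda>w. \<chi> i. polymap F w $ i)"
    by (intro continuous_on_vec_lambda)
  then show ?thesis by simp
qed

lemma polymap_F_derivative_0:
  "(polymap F has_derivative (\<lambda>h. vector [h $ 3, h $ 2, 2 * h $ 1])) (at 0)"
proof (rule has_derivative_vec_componentwise)
  fix i :: 3
  note nth = bounded_linear.has_derivative[OF bounded_linear_vec_nth has_derivative_ident]
  show "((\<lambda>w. polymap F w $ i) has_derivative
      (\<lambda>h. (vector [h $ 3, h $ 2, 2 * h $ 1] :: complex ^ 3) $ i)) (at 0)"
    using exhaust_3[of i]
    by (elim disjE; simp add: polymap_F Let_def power2_eq_square power3_eq_cube;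
        auto intro!: derivative_eq_intros nth)
qed

text \<open>
  The open mapping theorem at the origin, where the derivative $(x,y,z) \mapsto (z, y, 2x)$ is
  invertible, puts an open set into the image.
\<close>

lemma dominant_F: "dominant F"
  unfolding dominant_def
proof (intro allI impI)
  fix S assume S: "zariski_closed S \<and> range (polymap F) \<subseteq> S"
  then obtain I where I: "S = {w. \<forall>p\<in>I. eval3 p w = 0}"
    unfolding zariski_closed_def by blast
  let ?inv = "\<lambda>w::complex ^ 3. vector [w $ 3 / 2, w $ 2, w $ 1] :: complex ^ 3"
  have "linear ?inv"
    by (rule linearI) (simp_all add: vec_eq_iff forall_3 add_divide_distrib)
  then have "bounded_linear ?inv" by (rule linear_conv_bounded_linear[THEN iffD1])
  moreover have "(\<lambda>h. vector [h $ 3, h $ 2, 2 * h $ 1] :: complex ^ 3) \<circ> ?inv = id"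
    by (simp add: fun_eq_iff vec_eq_iff forall_3)
  ultimately have "polymap F 0 \<in> interior (range (polymap F))"
    using sussmann_open_mapping[OF open_UNIV continuous_on_polymap_F UNIV_I polymap_F_derivative_0]
    by simp
  then have "p \<in> {0}" if "p \<in> I" for p
    using S that interior_subset unfolding I singleton_iff
    by (intro eval3_zero_on_open[OF open_interior]) blast+
  then have "I \<subseteq> {0}" by blast
  then show "S = UNIV" unfolding I by auto
qed

theorem theorem7p1:
  shows
    "(\<exists>\<epsilon>::int. (\<epsilon> = 1 \<or> \<epsilon> = -1) \<and>
        (\<forall>G :: tripoly ^ 3. dominant G \<and> equivariant G \<longrightarrow>
           (\<exists>!(\<Lambda>, P, Q). quotient_data G \<Lambda> P Q) \<and>
           (\<forall>\<Lambda> P Q. quotient_data G \<Lambda> P Q \<longrightarrow>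
              \<Lambda> \<noteq> 0 \<and>
              to_fract (det (jacobian_matrix G)) =
                of_int \<epsilon> * (to_fract (at_uv (Jac_uv P Q)) / to_fract (at_uv \<Lambda>) ^ 2) \<and>
              (keller G \<longleftrightarrow> (\<exists>\<kappa>. \<kappa> \<noteq> 0 \<and> Jac_uv P Q = const2 \<kappa> * \<Lambda>\<^sup>2)) \<and>
              (keller G \<longleftrightarrow> vanishes_to_order_two_on (Jac_uv P Q) \<Lambda>)))) \<and>
     dominant F \<and> equivariant F \<and>
     (\<exists>P Q. quotient_data F L P Q \<and> Jac_uv P Q = 2 * L\<^sup>2)"
proof (intro conjI)
  have formulas: "\<Lambda> \<noteq> 0 \<and>
      to_fract (det (jacobian_matrix G)) =
        of_int (-1) * (to_fract (at_uv (Jac_uv P Q)) / to_fract (at_uv \<Lambda>) ^ 2) \<and>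
      (keller G \<longleftrightarrow> (\<exists>\<kappa>. \<kappa> \<noteq> 0 \<and> Jac_uv P Q = const2 \<kappa> * \<Lambda>\<^sup>2)) \<and>
      (keller G \<longleftrightarrow> vanishes_to_order_two_on (Jac_uv P Q) \<Lambda>)"
    if "dominant G" and data: "quotient_data G \<Lambda> P Q" for G \<Lambda> P Q
  proof -
    have nz: "\<Lambda> \<noteq> 0" using that by (rule dominant_quotient_nonzero)
    then have "to_fract (at_uv \<Lambda>) \<noteq> 0" using at_uv_inject[of \<Lambda> 0] by simp
    moreover have "to_fract (det (jacobian_matrix G)) * to_fract (at_uv \<Lambda>) ^ 2
        = - to_fract (at_uv (Jac_uv P Q))"
      using arg_cong[OF det_jacobian_quotient[OF data nz], of to_fract]
      by (simp add: power2_eq_square)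
    ultimately have "to_fract (det (jacobian_matrix G)) =
        of_int (-1) * (to_fract (at_uv (Jac_uv P Q)) / to_fract (at_uv \<Lambda>) ^ 2)"
      by (simp add: field_simps)
    then show ?thesis
      using nz keller_iff_quotient_Jacobian[OF data nz] vanishes_to_order_two_on_iff[OF nz]
      by metis
  qed
  have unique: "\<exists>!(\<Lambda>, P, Q). quotient_data G \<Lambda> P Q" if "equivariant G" for G
    using quotient_data_exists[OF that] quotient_data_unique[of G] by fast
  show "\<exists>\<epsilon>::int. (\<epsilon> = 1 \<or> \<epsilon> = -1) \<and>
        (\<forall>G :: tripoly ^ 3. dominant G \<and> equivariant G \<longrightarrow>
           (\<exists>!(\<Lambda>, P, Q). quotient_data G \<Lambda> P Q) \<and>
           (\<forall>\<Lambda> P Q. quotient_data G \<Lambda> P Q \<longrightarrow>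
              \<Lambda> \<noteq> 0 \<and>
              to_fract (det (jacobian_matrix G)) =
                of_int \<epsilon> * (to_fract (at_uv (Jac_uv P Q)) / to_fract (at_uv \<Lambda>) ^ 2) \<and>
              (keller G \<longleftrightarrow> (\<exists>\<kappa>. \<kappa> \<noteq> 0 \<and> Jac_uv P Q = const2 \<kappa> * \<Lambda>\<^sup>2)) \<and>
              (keller G \<longleftrightarrow> vanishes_to_order_two_on (Jac_uv P Q) \<Lambda>)))"
    by (rule exI[of _ "-1"]) (use formulas unique in blast)
qed (use dominant_F equivariant_F quotient_data_F in blast)+

end
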